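(* Let $U_{\vec a,\sigma}$ be a totally umbilical surface of $\mathbb{M}^3$, where $\mathbb{M}^3=\mathbb{H}^3$ or $\mathbb{M}^3=\mathbb{S}^3$, and let $H$ be its mean curvature. If $\alpha\colon I\subset\mathbb{R}\to\mathbb{M}^3$ is a regular curve contained in $U_{\vec a,\sigma}$ with constant non-zero torsion $\tau$ and with curvature $\kappa$ satisfying $\kappa'\neq0$ everywhere on $I$, then there is $a\in\mathbb{R}$ such that $$\kappa(s)=\frac{|H|}{\sin(\tau s+a)}\quad\text{for all } s\in I.$$
   Context: Model: put $c=-1$ for $\mathbb{H}^3$ and $c=1$ for $\mathbb{S}^3$, and endow $\mathbb{R}^4$ with the metric $\langle\cdot,\cdot\rangle=dx_1^2+dx_2^2+dx_3^2+c\,dx_4^2$. Then $\mathbb{H}^3=\{p\in\mathbb{R}^4:\langle p,p\rangle=-1,\ x_4>0\}$ and $\mathbb{S}^3=\{p\in\mathbb{R}^4:\langle p,p\rangle=1\}$, each with the induced Riemannian metric and Levi-Civita connection $\nabla$. Totally umbilical surfaces: these are the (nonempty) sets $U_{\vec a,\sigma}=\{p\in\mathbb{M}^3:\langle p,\vec a\rangle=\sigma\}$ with $\vec a\in\mathbb{R}^4$, $\vec a\neq0$, $\langle\vec a,\vec a\rangle=\epsilon\in\{-1,0,1\}$, $\sigma\in\mathbb{R}$. In $\mathbb{S}^3$: $\epsilon=1$, $\sigma\in(-1,1)$, and the mean curvature is $H=\sigma/\sqrt{1-\sigma^2}$. In $\mathbb{H}^3$: either $\epsilon=1$ and $\sigma$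 is arbitrary, or $\epsilon=0$ and $\sigma\neq0$, or $\epsilon=-1$ and $|\sigma|>1$; the mean curvature is $H=\sigma/\sqrt{\epsilon+\sigma^2}$. (The mean curvature is the common value of the principal curvatures, for a suitable choice of unit normal.) Curves: $I$ is an open interval; curves are of class at least $C^4$, parametrized by arc length $s$, and non-geodesic in the sense that $\kappa>0$ everywhere. The prime denotes $d/ds$. The curvature $\kappa$ and torsion $\tau$ are defined by the Frenet frame $\{T,N,B\}$ (orthonormal frame of $\mathbb{M}^3$ along $\alpha$, $T=\alpha'$, positively oriented for a fixed orientation) with $\nabla_TT=\kappa N$, $\nabla_TN=-\kappa T+\tau B$, $\nabla_TB=-\tau N$. "$\alpha$ is contained in $S$" means $\alpha(I)\subset S$. *)

theory Defs
  imports "HOL-Analysis.Analysis"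
begin

text \<open>The ambient metric of \<open>\<real>\<^sup>4\<close>; \<open>c = 1\<close> models the sphere, \<open>c = -1\<close> the hyperbolic space.\<close>

definition mip :: "real \<Rightarrow> real^4 \<Rightarrow> real^4 \<Rightarrow> real" where
  "mip c x y = x$1 * y$1 + x$2 * y$2 + x$3 * y$3 + c * (x$4 * y$4)"

definition space_form :: "real \<Rightarrow> (real^4) set" where
  "space_form c = {p. mip c p p = c \<and> (c = -1 \<longrightarrow> p$4 > 0)}"

definition tangent_space :: "real \<Rightarrow> real^4 \<Rightarrow> (real^4) set" where
  "tangent_space c p = {v. mip c v p = 0}"

text \<open>Orthogonal projection of \<open>\<real>\<^sup>4\<close> onto the tangent space of the space form at \<open>p\<close>.
  The Levi-Civita connection of the induced metric is the tangential component of the flat ambient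
  derivative, so covariant derivatives below are \<open>tangential c p\<close> of ordinary ones.\<close>

definition tangential :: "real \<Rightarrow> real^4 \<Rightarrow> real^4 \<Rightarrow> real^4" where
  "tangential c p v = v - (mip c v p / mip c p p) *\<^sub>R p"

definition has_cov_deriv ::
  "real \<Rightarrow> (real \<Rightarrow> real^4) \<Rightarrow> (real \<Rightarrow> real^4) \<Rightarrow> real^4 \<Rightarrow> real \<Rightarrow> bool" where
  "has_cov_deriv c \<alpha> V W s \<longleftrightarrow>
     (\<exists>V'. (V has_vector_derivative V') (at s) \<and> W = tangential c (\<alpha> s) V')"

definition umb_set :: "real \<Rightarrow> real^4 \<Rightarrow> real \<Rightarrow> (real^4) set" where
  "umb_set c a \<sigma> = {p \<in> space_form c. mip c p a = \<sigma>}"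

definition umbilical_surface :: "real \<Rightarrow> real^4 \<Rightarrow> real \<Rightarrow> bool" where
  "umbilical_surface c a \<sigma> \<longleftrightarrow> a \<noteq> 0 \<and> umb_set c a \<sigma> \<noteq> {} \<and>
     (c = 1 \<and> mip c a a = 1 \<and> -1 < \<sigma> \<and> \<sigma> < 1
      \<or> c = -1 \<and> (mip c a a = 1 \<or> mip c a a = 0 \<and> \<sigma> \<noteq> 0 \<or> mip c a a = -1 \<and> \<bar>\<sigma>\<bar> > 1))"

text \<open>Tangent space at \<open>p\<close> of the level set \<open>umb_set c a \<sigma>\<close>, cut out of the tangent space of the
  space form by the differential of \<open>mip c _ a\<close>.\<close>

definition umb_tangent :: "real \<Rightarrow> real^4 \<Rightarrow> real^4 \<Rightarrow> (real^4) set" where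
  "umb_tangent c a p = {v \<in> tangent_space c p. mip c v a = 0}"

text \<open>A unit normal field is represented by an extension to \<open>\<real>\<^sup>4\<close>, differentiable at the points
  of the surface; its derivatives in directions tangent to the surface do not depend on the
  extension.\<close>

definition unit_normal_field :: "real \<Rightarrow> real^4 \<Rightarrow> real \<Rightarrow> (real^4 \<Rightarrow> real^4) \<Rightarrow> bool" where
  "unit_normal_field c a \<sigma> \<nu> \<longleftrightarrow>
     (\<forall>p \<in> umb_set c a \<sigma>. \<nu> differentiable (at p) \<and> \<nu> p \<in> tangent_space c p \<and>
        mip c (\<nu> p) (\<nu> p) = 1 \<and> (\<forall>v \<in> umb_tangent c a p. mip c (\<nu> p) v = 0))"

definition shape_operator :: "real \<Rightarrow> (real^4 \<Rightarrow> real^4) \<Rightarrow> real^4 \<Rightarrow> real^4 \<Rightarrow> real^4" where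
  "shape_operator c \<nu> p v = - tangential c p (frechet_derivative \<nu> (at p) v)"

definition principal_curvatures ::
  "real \<Rightarrow> real^4 \<Rightarrow> (real^4 \<Rightarrow> real^4) \<Rightarrow> real^4 \<Rightarrow> real set" where
  "principal_curvatures c a \<nu> p =
     {k. \<exists>v \<in> umb_tangent c a p. v \<noteq> 0 \<and> shape_operator c \<nu> p v = k *\<^sub>R v}"

text \<open>\<open>H\<close> is the common value of all principal curvatures, for some choice of unit normal;
  it is thus only determined up to sign.\<close>

definition is_mean_curvature :: "real \<Rightarrow> real^4 \<Rightarrow> real \<Rightarrow> real \<Rightarrow> bool" where
  "is_mean_curvature c a \<sigma> H \<longleftrightarrow>
     (\<exists>\<nu>. unit_normal_field c a \<sigma> \<nu> \<and>
          (\<forall>p \<in> umb_set c a \<sigma>. principal_curvatures c a \<nu> p = {H}))"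

text \<open>\<open>C\<^sup>k\<close> regularity on an open set of parameters.\<close>

fun Ck_curve :: "nat \<Rightarrow> real set \<Rightarrow> (real \<Rightarrow> real^4) \<Rightarrow> bool" where
  "Ck_curve 0 I f \<longleftrightarrow> continuous_on I f"
| "Ck_curve (Suc k) I f \<longleftrightarrow>
     (\<exists>f'. (\<forall>s\<in>I. (f has_vector_derivative f' s) (at s)) \<and> Ck_curve k I f')"

text \<open>\<open>\<omega> = 1\<close> and \<open>\<omega> = -1\<close> select the two orientations of the (connected) space form:
  a tangent frame \<open>(u, v, w)\<close> at \<open>p\<close> is positive iff \<open>\<omega> * det (u, v, w, p) > 0\<close>.\<close>

definition positive_orthonormal_frame ::
  "real \<Rightarrow> real \<Rightarrow> real^4 \<Rightarrow> real^4 \<Rightarrow> real^4 \<Rightarrow> real^4 \<Rightarrow> bool" where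
  "positive_orthonormal_frame c \<omega> p u v w \<longleftrightarrow>
     {u, v, w} \<subseteq> tangent_space c p \<and>
     mip c u u = 1 \<and> mip c v v = 1 \<and> mip c w w = 1 \<and>
     mip c u v = 0 \<and> mip c u w = 0 \<and> mip c v w = 0 \<and>
     \<omega> * det (vector [u, v, w, p] :: real^4^4) > 0"

text \<open>\<open>T, N, B\<close> is the Frenet frame, and \<open>\<kappa> > 0\<close>, \<open>\<tau>\<close> are the curvature and torsion, of the
  curve \<open>\<alpha>\<close>; since \<open>T\<close> is a unit field, \<open>\<alpha>\<close> is parametrized by arc length.\<close>

definition frenet ::
  "real \<Rightarrow> real \<Rightarrow> real set \<Rightarrow> (real \<Rightarrow> real^4) \<Rightarrow> (real \<Rightarrow> real^4) \<Rightarrow> (real \<Rightarrow> real^4) \<Rightarrow>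
   (real \<Rightarrow> real^4) \<Rightarrow> (real \<Rightarrow> real) \<Rightarrow> (real \<Rightarrow> real) \<Rightarrow> bool" where
  "frenet c \<omega> I \<alpha> T N B \<kappa> \<tau> \<longleftrightarrow>
     (\<forall>s\<in>I. (\<alpha> has_vector_derivative T s) (at s) \<and>
        positive_orthonormal_frame c \<omega> (\<alpha> s) (T s) (N s) (B s) \<and>
        \<kappa> s > 0 \<and>
        has_cov_deriv c \<alpha> T (\<kappa> s *\<^sub>R N s) s \<and>
        has_cov_deriv c \<alpha> N (- \<kappa> s *\<^sub>R T s + \<tau> s *\<^sub>R B s) s \<and>
        has_cov_deriv c \<alpha> B (- \<tau> s *\<^sub>R N s) s)"

text \<open>Consistency check: \<open>is_mean_curvature\<close> is satisfied by the classical closed formula.\<close>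

lemma is_mean_curvature_umbilical:
  assumes "umbilical_surface c a \<sigma>"
  shows "is_mean_curvature c a \<sigma> (\<sigma> / sqrt (mip c a a - c * \<sigma>\<^sup>2))"
proof -
  define r where "r = sqrt (mip c a a - c * \<sigma>\<^sup>2)"
  have c: "c * c = 1" "c \<noteq> 0" using assms by (auto simp: umbilical_surface_def)
  have pos: "mip c a a - c * \<sigma>\<^sup>2 > 0"
  proof -
    have 1: "\<sigma>\<^sup>2 < 1" if "-1 < \<sigma>" "\<sigma> < 1" using that by (simp add: abs_square_less_1)
    have 2: "\<sigma>\<^sup>2 > 1" if "\<bar>\<sigma>\<bar> > 1"
      using that one_less_power[of "\<bar>\<sigma>\<bar>" 2] by simp
    have 3: "\<sigma>\<^sup>2 > 0" if "\<sigma> \<noteq> 0" using that by simp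
    show ?thesis
    proof -
      consider "c = 1" "mip c a a = 1" "-1 < \<sigma>" "\<sigma> < 1" | "c = -1" "mip c a a = 1"
        | "c = -1" "mip c a a = 0" "\<sigma> \<noteq> 0" | "c = -1" "mip c a a = -1" "\<bar>\<sigma>\<bar> > 1"
        using assms unfolding umbilical_surface_def by blast
      then show ?thesis
      proof cases
        case 2
        then show ?thesis using zero_le_power2[of \<sigma>] by (simp add: add_pos_nonneg)
      qed (use 1 2 3 in simp_all)
    qed
  qed
  have r: "r > 0" "r * r = mip c a a - c * \<sigma>\<^sup>2" using pos by (auto simp: r_def)
  define \<nu> where "\<nu> = (\<lambda>p. (1 / r) *\<^sub>R (c *\<^sub>R a - \<sigma> *\<^sub>R p))"
  have d: "(\<nu> has_derivative (\<lambda>v. - (\<sigma> / r) *\<^sub>R v)) (at p)" for p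
    unfolding \<nu>_def by (rule derivative_eq_intros refl)+ (simp add: divide_inverse mult.commute)
  have bil: "mip c (x *\<^sub>R u - y *\<^sub>R v) w = x * mip c u w - y * mip c v w"
    "mip c (x *\<^sub>R u) w = x * mip c u w" "mip c u w = mip c w u"
    "mip c w (x *\<^sub>R u - y *\<^sub>R v) = x * mip c w u - y * mip c w v"
    "mip c w (x *\<^sub>R u) = x * mip c w u" for x y u v w
    by (auto simp: mip_def algebra_simps)
  have sh: "shape_operator c \<nu> p v = (\<sigma> / r) *\<^sub>R v" if "v \<in> umb_tangent c a p" for p v
  proof -
    have "mip c v p = 0" using that by (simp add: umb_tangent_def tangent_space_def)
    then have "mip c (- (\<sigma> / r) *\<^sub>R v) p = 0" by (simp only: bil(2) mult_zero_right)
    then show ?thesis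
      by (simp add: shape_operator_def tangential_def frechet_derivative_at[OF d[of p], symmetric])
  qed
  have nf: "unit_normal_field c a \<sigma> \<nu>"
    unfolding unit_normal_field_def
  proof (intro ballI conjI)
    fix p assume "p \<in> umb_set c a \<sigma>"
    then have p: "mip c p p = c" "mip c p a = \<sigma>" "mip c a p = \<sigma>"
      using bil(3) by (auto simp: umb_set_def space_form_def)
    show "\<nu> differentiable at p" using d by (auto simp: differentiable_def)
    show "\<nu> p \<in> tangent_space c p"
      by (simp add: tangent_space_def \<nu>_def bil(1,2) p)
    have "mip c (\<nu> p) (\<nu> p) = (1 / (r * r)) * (c * (c * mip c a a - \<sigma> * \<sigma>) - \<sigma> * (c * \<sigma> - \<sigma> * c))"
      unfolding \<nu>_def bil(1,2,4,5) p by (simp add: field_simps)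
    also have "c * (c * mip c a a - \<sigma> * \<sigma>) - \<sigma> * (c * \<sigma> - \<sigma> * c) = (c * c) * mip c a a - c * \<sigma>\<^sup>2"
      by (simp add: algebra_simps power2_eq_square)
    also have "\<dots> = r * r" by (simp add: c(1) r(2))
    finally show "mip c (\<nu> p) (\<nu> p) = 1" using r(1) by simp
    show "mip c (\<nu> p) v = 0" if "v \<in> umb_tangent c a p" for v
      using that bil(3)[of v] by (simp add: umb_tangent_def tangent_space_def \<nu>_def bil(1,2))
  qed
  have ex: "\<exists>v. v \<in> umb_tangent c a p \<and> v \<noteq> 0" for p
  proof -
    define J where "J = (\<lambda>x::real^4. (\<chi> i. if i = 4 then c * x$4 else x$i))"
    have J: "mip c v x = v \<bullet> J x" for v x
      by (simp add: mip_def J_def inner_vec_def sum_4 algebra_simps)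
    have "dim {J p, J a} \<le> card {J p, J a}" by (rule dim_le_card') simp
    also have "\<dots> < DIM(real^4)" by (simp add: card_insert_if)
    finally obtain v where "v \<noteq> 0" "\<And>y. y \<in> span {J p, J a} \<Longrightarrow> orthogonal v y"
      using orthogonal_to_subspace_exists[of "{J p, J a}"] by auto
    then show ?thesis
      by (intro exI[of _ v]) (auto simp: umb_tangent_def tangent_space_def J orthogonal_def span_base)
  qed
  have "principal_curvatures c a \<nu> p = {\<sigma> / r}" for p
    using ex[of p] by (auto simp: principal_curvatures_def sh)
  then show ?thesis using nf unfolding is_mean_curvature_def r_def by blast
qed

end

theory Submission
  imports Defs
begin

text \<open>
  Let \<open>r\<^sup>2 = \<langle>a, a\<rangle> - c \<sigma>\<^sup>2\<close>, which is positive for each of the admitted surfaces. The whole proof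
  consists in following the fixed vector \<open>a\<close> through the Frenet frame of the curve. Since
  \<open>\<langle>\<alpha>, a\<rangle> = \<sigma>\<close> is constant, \<open>\<langle>T, a\<rangle> = 0\<close>; differentiating once more, with the ambient Frenet
  equation \<open>T' = \<kappa> N - c \<alpha>\<close>, gives \<open>\<kappa> \<langle>N, a\<rangle> = c \<sigma>\<close>. The equations \<open>N' = - \<kappa> T + \<tau> B\<close> and
  \<open>B' = - \<tau> N\<close> turn into \<open>\<langle>N, a\<rangle>' = \<tau> \<langle>B, a\<rangle>\<close> and \<open>\<langle>B, a\<rangle>' = - \<tau> \<langle>N, a\<rangle>\<close>: for constant torsion
  the pair \<open>(\<langle>N, a\<rangle>, \<langle>B, a\<rangle>)\<close> rotates uniformly on a circle
  (lemma \<open>uniform_rotation_solution\<close>), and by Parseval's identity in the basis \<open>T, N, B, \<alpha>\<close>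
  the radius of this circle is \<open>r\<close>. Hence \<open>\<langle>N, a\<rangle> = \<plusminus> r sin (\<tau> s + b)\<close>, that is,
  \<open>\<kappa> = (\<bar>\<sigma>\<bar> / r) / sin (\<tau> s + b)\<close>.

  It remains to see that \<open>\<bar>H\<bar> = \<bar>\<sigma>\<bar> / r\<close> whichever unit normal field was used to compute \<open>H\<close>
  (lemma \<open>abs_mean_curvature\<close>). At each point a unit normal is \<open>\<plusminus>\<mu>\<close> with
  \<open>\<mu> = (c a - \<sigma> p) / r\<close>, and along a curve on the surface the sign is a differentiable function
  with constant square. Its derivative vanishes, so the velocity of the curve is an eigenvector of
  the shape operator with eigenvalue \<open>\<plusminus>\<sigma> / r\<close>.
\<close>

section \<open>The ambient bilinear form\<close>

lemma mip_commute: "mip c x y = mip c y x"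
  by (simp add: mip_def mult.commute)

lemma mip_linear:
  "mip c (x + y) z = mip c x z + mip c y z"
  "mip c (x - y) z = mip c x z - mip c y z"
  "mip c (- x) z = - mip c x z"
  "mip c (k *\<^sub>R x) z = k * mip c x z"
  "mip c z (x + y) = mip c z x + mip c z y"
  "mip c z (x - y) = mip c z x - mip c z y"
  "mip c z (- x) = - mip c z x"
  "mip c z (k *\<^sub>R x) = k * mip c z x"
  by (simp_all add: mip_def algebra_simps)

lemma bounded_bilinear_mip: "bounded_bilinear (mip c)"
proof -
  have "bilinear (mip c)"
    by (auto simp: bilinear_def intro!: linearI simp: mip_linear)
  then show ?thesis by (simp add: bilinear_conv_bounded_bilinear)
qed

lemma has_real_derivative_mip:
  assumes "(f has_vector_derivative f') (at s)" "(g has_vector_derivative g') (at s)"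
  shows "((\<lambda>s. mip c (f s) (g s)) has_real_derivative mip c (f s) g' + mip c f' (g s)) (at s)"
  unfolding has_real_derivative_iff_has_vector_derivative
  by (rule bounded_bilinear.has_vector_derivative[OF bounded_bilinear_mip assms])

lemma has_real_derivative_mip_const:
  assumes "(f has_vector_derivative f') (at s)"
  shows "((\<lambda>s. mip c (f s) a) has_real_derivative mip c f' a) (at s)"
  using has_real_derivative_mip[OF assms has_vector_derivative_const[of a]]
  by (simp add: mip_def)

text \<open>Every algebraic identity along the curve is differentiated by means of this fact.\<close>

lemma derivative_of_constant_on_open:
  fixes f :: "real \<Rightarrow> real"
  assumes "open I" "s \<in> I" "\<And>t. t \<in> I \<Longrightarrow> f t = k" "(f has_real_derivative d) (at s)"
  shows "d = 0"
proof -
  have "((\<lambda>_. k) has_real_derivative d) (at s)"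
    using has_field_derivative_transform_within_open[OF assms(4,1,2)] assms(3) by simp
  then show ?thesis using DERIV_const DERIV_unique by blast
qed

text \<open>In the hyperbolic case the ambient form is indefinite. Tangent vectors are nevertheless spacelike:
  tangency reads \<open>d\<^sub>4 p\<^sub>4 = d\<^sub>1 p\<^sub>1 + d\<^sub>2 p\<^sub>2 + d\<^sub>3 p\<^sub>3\<close>, and the Cauchy--Schwarz inequality together with
  \<open>p\<^sub>1\<^sup>2 + p\<^sub>2\<^sup>2 + p\<^sub>3\<^sup>2 = p\<^sub>4\<^sup>2 - 1\<close> bounds \<open>(d\<^sub>4 p\<^sub>4)\<^sup>2\<close> by \<open>d\<^sub>4\<^sup>2 (p\<^sub>4\<^sup>2 - 1)\<close> for a null vector \<open>d\<close>.\<close>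

lemma null_tangent_vector_is_zero:
  assumes "c = -1 \<or> c = 1" "p \<in> space_form c" "d \<in> tangent_space c p" "mip c d d = 0"
  shows "d = 0"
proof -
  have sq: "d = 0" if "(d$1)\<^sup>2 + (d$2)\<^sup>2 + (d$3)\<^sup>2 + (d$4)\<^sup>2 = 0"
  proof -
    have "d$1 = 0 \<and> d$2 = 0 \<and> d$3 = 0 \<and> d$4 = 0"
      using that zero_le_power2[of "d$1"] zero_le_power2[of "d$2"] zero_le_power2[of "d$3"]
        zero_le_power2[of "d$4"]
      by (simp add: add_nonneg_eq_0_iff)
    then show ?thesis by (simp add: vec_eq_iff forall_4)
  qed
  show ?thesis using assms(1)
  proof
    assume "c = 1"
    then show ?thesis using assms(4) by (intro sq) (simp add: mip_def power2_eq_square)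
  next
    assume c: "c = -1"
    define P D where "P = (p$1)\<^sup>2 + (p$2)\<^sup>2 + (p$3)\<^sup>2" and "D = (d$1)\<^sup>2 + (d$2)\<^sup>2 + (d$3)\<^sup>2"
    have P: "P = (p$4)\<^sup>2 - 1" and D: "D = (d$4)\<^sup>2"
      and orth: "d$1 * p$1 + d$2 * p$2 + d$3 * p$3 = d$4 * p$4"
      using assms(2-4) c
      by (auto simp: space_form_def tangent_space_def mip_def P_def D_def power2_eq_square)
    have "(d$1 * p$1 + d$2 * p$2 + d$3 * p$3)\<^sup>2 =
      D * P - ((d$1 * p$2 - d$2 * p$1)\<^sup>2 + (d$1 * p$3 - d$3 * p$1)\<^sup>2 + (d$2 * p$3 - d$3 * p$2)\<^sup>2)"
      unfolding P_def D_def by algebra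
    moreover have "0 \<le> (d$1 * p$2 - d$2 * p$1)\<^sup>2" "0 \<le> (d$1 * p$3 - d$3 * p$1)\<^sup>2"
      "0 \<le> (d$2 * p$3 - d$3 * p$2)\<^sup>2" by simp_all
    ultimately have "(d$4 * p$4)\<^sup>2 \<le> D * P" unfolding orth by linarith
    then have "(d$4)\<^sup>2 \<le> 0"
      unfolding P D by (simp add: power_mult_distrib algebra_simps)
    then have "d$4 = 0" by simp
    then show ?thesis using D by (intro sq) (simp add: D_def)
  qed
qed

text \<open>Completeness of the frame comes from its determinant: a vector orthogonal to all four rows is
  annihilated by an invertible matrix, once the form is rewritten as the Euclidean inner product with
  the reflected vector \<open>J x\<close>.\<close>

lemma orthonormal_frame_expansion:
  assumes "c = -1 \<or> c = 1" "p \<in> space_form c" "positive_orthonormal_frame c \<omega> p u v w"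
  shows "x = mip c x u *\<^sub>R u + mip c x v *\<^sub>R v + mip c x w *\<^sub>R w + (c * mip c x p) *\<^sub>R p"
proof -
  define d where "d = x - (mip c x u *\<^sub>R u + mip c x v *\<^sub>R v + mip c x w *\<^sub>R w + (c * mip c x p) *\<^sub>R p)"
  define J where "J = (\<lambda>x::real^4. (\<chi> i. if i = 4 then c * x$4 else x$i))"
  define M where "M = (vector [u, v, w, p] :: real^4^4)"
  have cc: "c * c = 1" using assms(1) by auto
  have fr: "mip c u p = 0" "mip c v p = 0" "mip c w p = 0"
    "mip c u u = 1" "mip c v v = 1" "mip c w w = 1" "mip c u v = 0" "mip c u w = 0" "mip c v w = 0"
    "mip c p p = c" "det M \<noteq> 0"
    using assms(2,3)
    by (auto simp: positive_orthonormal_frame_def tangent_space_def space_form_def M_def)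
  have fr': "mip c p u = 0" "mip c p v = 0" "mip c p w = 0" "mip c v u = 0" "mip c w u = 0" "mip c w v = 0"
    using fr mip_commute by metis+
  have orth: "mip c d u = 0" "mip c d v = 0" "mip c d w = 0" "mip c d p = 0"
    using cc by (auto simp: d_def mip_linear fr fr' algebra_simps)
  have J: "mip c d y = (\<Sum>i\<in>UNIV. y$i * J d $ i)" for y
    by (simp add: mip_def J_def sum_4 algebra_simps)
  have "M *v J d = 0"
    using orth by (simp add: vec_eq_iff forall_4 matrix_vector_mult_def M_def J vector_def)
  moreover have "invertible M" using fr by (simp add: invertible_det_nz)
  ultimately have "J d = 0"
    by (metis invertible_def matrix_vector_mul_assoc matrix_vector_mul_lid matrix_vector_mult_0_right)
  then have "d = 0" using cc by (auto simp: J_def vec_eq_iff forall_4)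
  then show ?thesis by (simp add: d_def)
qed

section \<open>The mean curvature of a totally umbilical surface\<close>

lemma umbilical_surface_radius_pos:
  assumes "umbilical_surface c a \<sigma>"
  shows "mip c a a - c * \<sigma>\<^sup>2 > 0"
proof -
  have "\<sigma>\<^sup>2 < 1" if "-1 < \<sigma>" "\<sigma> < 1" using that by (simp add: abs_square_less_1)
  moreover have "\<sigma>\<^sup>2 > 1" if "\<bar>\<sigma>\<bar> > 1" using that one_less_power[of "\<bar>\<sigma>\<bar>" 2] by simp
  moreover have "1 + \<sigma>\<^sup>2 > 0" by (simp add: add_pos_nonneg)
  ultimately show ?thesis
    using assms by (auto simp: umbilical_surface_def)
qed

text \<open>Subtracting from \<open>\<nu> p\<close> its \<open>\<mu>\<close>-component leaves a vector that is tangent to the surface and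
  hence orthogonal to both \<open>\<nu> p\<close> and \<open>\<mu>\<close>. It is therefore null, and so it vanishes.\<close>

lemma unit_normal_unique_up_to_sign:
  assumes c: "c = -1 \<or> c = 1" and p: "p \<in> umb_set c a \<sigma>"
    and \<nu>: "unit_normal_field c a \<sigma> \<nu>"
    and r: "r > 0" "r\<^sup>2 = mip c a a - c * \<sigma>\<^sup>2"
  defines "\<mu> \<equiv> (1 / r) *\<^sub>R (c *\<^sub>R a - \<sigma> *\<^sub>R p)"
  shows "\<nu> p = mip c (\<nu> p) \<mu> *\<^sub>R \<mu>" "(mip c (\<nu> p) \<mu>)\<^sup>2 = 1"
proof -
  have cc: "c * c = 1" "c * (c * x) = x" for x using c by auto
  have pp: "p \<in> space_form c" "mip c p p = c" "mip c p a = \<sigma>" "mip c a p = \<sigma>"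
    using p mip_commute[of c a p] by (auto simp: umb_set_def space_form_def)
  have \<nu>p: "mip c (\<nu> p) p = 0" "mip c (\<nu> p) (\<nu> p) = 1"
    "\<And>v. v \<in> umb_tangent c a p \<Longrightarrow> mip c (\<nu> p) v = 0"
    using \<nu> p by (auto simp: unit_normal_field_def tangent_space_def)
  have \<mu>p: "mip c \<mu> p = 0" by (simp add: \<mu>_def mip_linear pp)
  have \<mu>a: "mip c \<mu> a = c * r"
  proof -
    have "mip c \<mu> a = (1 / r) * (c * (mip c a a - c * \<sigma>\<^sup>2))"
      by (simp add: \<mu>_def mip_linear pp cc right_diff_distrib power2_eq_square)
    then show ?thesis using r(1) unfolding r(2)[symmetric] by (simp add: power2_eq_square)
  qed
  have a: "a = (c * r) *\<^sub>R \<mu> + (c * \<sigma>) *\<^sub>R p"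
    using r(1) by (simp add: \<mu>_def algebra_simps cc)
  have \<mu>\<mu>: "mip c \<mu> \<mu> = 1"
  proof -
    have "c * r = c * r * mip c \<mu> \<mu>"
      using \<mu>a by (subst (asm) a) (simp add: mip_linear \<mu>p)
    then show ?thesis using r(1) c by auto
  qed
  define e where "e = mip c (\<nu> p) \<mu>"
  define d where "d = \<nu> p - e *\<^sub>R \<mu>"
  have dp: "mip c d p = 0" by (simp add: d_def mip_linear \<nu>p \<mu>p)
  have d\<mu>: "mip c d \<mu> = 0" by (simp add: d_def mip_linear \<mu>\<mu> e_def)
  have "mip c d a = 0" by (subst a) (simp add: mip_linear dp d\<mu>)
  then have "mip c (\<nu> p) d = 0"
    using dp \<nu>p(3) by (simp add: umb_tangent_def tangent_space_def)
  then have "mip c d d = 0"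
    using d\<mu> mip_commute[of c \<mu> d] by (subst d_def) (simp add: mip_linear)
  then have "d = 0"
    using null_tangent_vector_is_zero[OF c pp(1)] dp by (simp add: tangent_space_def)
  then have eq: "\<nu> p = e *\<^sub>R \<mu>" by (simp add: d_def)
  then show "\<nu> p = mip c (\<nu> p) \<mu> *\<^sub>R \<mu>" by (simp add: e_def)
  have "e\<^sup>2 = 1" using \<nu>p(2) by (simp add: eq mip_linear \<mu>\<mu> power2_eq_square)
  then show "(mip c (\<nu> p) \<mu>)\<^sup>2 = 1" by (simp add: e_def)
qed

text \<open>A single regular point of a single curve on the surface suffices, because the velocity there
  is an eigenvector of the shape operator for every choice of unit normal field.\<close>

lemma abs_mean_curvature:
  assumes c: "c = -1 \<or> c = 1" and H: "is_mean_curvature c a \<sigma> H"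
    and r: "r > 0" "r\<^sup>2 = mip c a a - c * \<sigma>\<^sup>2"
    and I: "open I" "s \<in> I" and \<alpha>: "\<alpha> ` I \<subseteq> umb_set c a \<sigma>"
    and v: "(\<alpha> has_vector_derivative v) (at s)" "v \<noteq> 0"
  shows "\<bar>H\<bar> = \<bar>\<sigma>\<bar> / r"
proof -
  obtain \<nu> where \<nu>: "unit_normal_field c a \<sigma> \<nu>"
    and pc: "\<And>p. p \<in> umb_set c a \<sigma> \<Longrightarrow> principal_curvatures c a \<nu> p = {H}"
    using H by (auto simp: is_mean_curvature_def)
  have on: "mip c (\<alpha> t) (\<alpha> t) = c" "mip c (\<alpha> t) a = \<sigma>" "\<alpha> t \<in> umb_set c a \<sigma>" if "t \<in> I" for t
    using \<alpha> that by (auto simp: umb_set_def space_form_def)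
  define \<mu> where "\<mu> = (\<lambda>t. (1 / r) *\<^sub>R (c *\<^sub>R a - \<sigma> *\<^sub>R \<alpha> t))"
  define e where "e = (\<lambda>t. mip c (\<nu> (\<alpha> t)) (\<mu> t))"
  have \<nu>e: "\<nu> (\<alpha> t) = e t *\<^sub>R \<mu> t" and e1: "(e t)\<^sup>2 = 1" if "t \<in> I" for t
    using unit_normal_unique_up_to_sign[OF c on(3)[OF that] \<nu> r] by (simp_all add: e_def \<mu>_def)
  define D where "D = frechet_derivative \<nu> (at (\<alpha> s)) v"
  have "(\<nu> has_derivative frechet_derivative \<nu> (at (\<alpha> s))) (at (\<alpha> s))"
    using \<nu> on(3)[OF I(2)] by (simp add: unit_normal_field_def frechet_derivative_works)
  then have d\<nu>: "((\<lambda>t. \<nu> (\<alpha> t)) has_vector_derivative D) (at s)"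
    using vector_derivative_diff_chain_within[OF v(1)] has_derivative_at_withinI
    unfolding D_def o_def by blast
  have d\<mu>: "(\<mu> has_vector_derivative - (\<sigma> / r) *\<^sub>R v) (at s)"
    unfolding \<mu>_def by (rule derivative_eq_intros v(1) refl)+ simp
  define e' where "e' = mip c (\<nu> (\<alpha> s)) (- (\<sigma> / r) *\<^sub>R v) + mip c D (\<mu> s)"
  have de: "(e has_real_derivative e') (at s)"
    unfolding e_def e'_def by (rule has_real_derivative_mip[OF d\<nu> d\<mu>])
  have "((\<lambda>t. (e t)\<^sup>2) has_real_derivative 2 * e s * e') (at s)"
    by (rule derivative_eq_intros de refl)+ simp
  from derivative_of_constant_on_open[OF I e1 this] have e'0: "e' = 0"
    using e1[OF I(2)] by auto
  have "((\<lambda>t. e t *\<^sub>R \<mu> t) has_vector_derivative e s *\<^sub>R (- (\<sigma> / r) *\<^sub>R v) + e' *\<^sub>R \<mu> s) (at s)"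
    by (rule has_vector_derivative_scaleR[OF de d\<mu>])
  then have "((\<lambda>t. \<nu> (\<alpha> t)) has_vector_derivative e s *\<^sub>R (- (\<sigma> / r) *\<^sub>R v)) (at s)"
    using has_vector_derivative_transform_within_open[OF _ I(1,2)] \<nu>e e'0 by fastforce
  with d\<nu> have D: "D = - (e s * (\<sigma> / r)) *\<^sub>R v"
    using vector_derivative_unique_at by fastforce
  have "mip c (\<alpha> s) v + mip c v (\<alpha> s) = 0"
    by (rule derivative_of_constant_on_open[OF I on(1) has_real_derivative_mip[OF v(1) v(1)]])
  then have vp: "mip c v (\<alpha> s) = 0" using mip_commute[of c v] by simp
  have va: "mip c v a = 0"
    by (rule derivative_of_constant_on_open[OF I on(2) has_real_derivative_mip_const[OF v(1)]])
  have "shape_operator c \<nu> (\<alpha> s) v = (e s * (\<sigma> / r)) *\<^sub>R v"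
    unfolding shape_operator_def D_def[symmetric] by (simp add: D tangential_def mip_linear vp)
  then have "e s * (\<sigma> / r) \<in> principal_curvatures c a \<nu> (\<alpha> s)"
    using v(2) vp va unfolding principal_curvatures_def umb_tangent_def tangent_space_def by blast
  then have "H = e s * (\<sigma> / r)" using pc on(3)[OF I(2)] by simp
  moreover have "\<bar>e s\<bar> = 1" using e1[OF I(2)] by (auto simp: power2_eq_1_iff)
  ultimately show ?thesis using r(1) by (simp add: abs_mult)
qed

section \<open>The ambient Frenet equations\<close>

text \<open>The normal part of the ambient derivative of a tangent field is fixed by differentiating
  \<open>\<langle>V, \<alpha>\<rangle> = 0\<close>.\<close>

lemma ambient_derivative_of_tangent_field:
  assumes c: "c = -1 \<or> c = 1" and I: "open I" "s \<in> I"
    and \<alpha>: "\<alpha> s \<in> space_form c" "(\<alpha> has_vector_derivative v) (at s)"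
    and V: "\<And>t. t \<in> I \<Longrightarrow> V t \<in> tangent_space c (\<alpha> t)" "has_cov_deriv c \<alpha> V W s"
  shows "(V has_vector_derivative W - (c * mip c (V s) v) *\<^sub>R \<alpha> s) (at s)"
proof -
  obtain V' where V': "(V has_vector_derivative V') (at s)" "W = tangential c (\<alpha> s) V'"
    using V(2) by (auto simp: has_cov_deriv_def)
  have "mip c (V s) v + mip c V' (\<alpha> s) = 0"
    using V(1) derivative_of_constant_on_open[OF I _ has_real_derivative_mip[OF V'(1) \<alpha>(2)]]
    by (auto simp: tangent_space_def)
  then have "mip c V' (\<alpha> s) = - mip c (V s) v" by simp
  moreover have "mip c (\<alpha> s) (\<alpha> s) = c" using \<alpha>(1) by (simp add: space_form_def)
  ultimately have "V' = W - (c * mip c (V s) v) *\<^sub>R \<alpha> s"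
    using c by (auto simp: V'(2) tangential_def)
  with V'(1) show ?thesis by simp
qed

lemma frenet_ambient:
  assumes c: "c = -1 \<or> c = 1" and I: "open I" "s \<in> I"
    and \<alpha>: "\<alpha> ` I \<subseteq> space_form c" and fr: "frenet c \<omega> I \<alpha> T N B \<kappa> \<tau>"
  shows "(T has_vector_derivative \<kappa> s *\<^sub>R N s - c *\<^sub>R \<alpha> s) (at s)"
    and "(N has_vector_derivative - \<kappa> s *\<^sub>R T s + \<tau> s *\<^sub>R B s) (at s)"
    and "(B has_vector_derivative - \<tau> s *\<^sub>R N s) (at s)"
proof -
  have tan: "T t \<in> tangent_space c (\<alpha> t)" "N t \<in> tangent_space c (\<alpha> t)"
    "B t \<in> tangent_space c (\<alpha> t)" if "t \<in> I" for t
    using fr that by (auto simp: frenet_def positive_orthonormal_frame_def)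
  have \<alpha>s: "\<alpha> s \<in> space_form c" "(\<alpha> has_vector_derivative T s) (at s)"
    using \<alpha> fr I by (auto simp: frenet_def)
  have cov: "has_cov_deriv c \<alpha> T (\<kappa> s *\<^sub>R N s) s"
    "has_cov_deriv c \<alpha> N (- \<kappa> s *\<^sub>R T s + \<tau> s *\<^sub>R B s) s"
    "has_cov_deriv c \<alpha> B (- \<tau> s *\<^sub>R N s) s"
    using fr I by (auto simp: frenet_def)
  have TT: "mip c (T s) (T s) = 1" and NT: "mip c (N s) (T s) = 0" and BT: "mip c (B s) (T s) = 0"
    using fr I mip_commute[of c "N s" "T s"] mip_commute[of c "B s" "T s"]
    by (auto simp: frenet_def positive_orthonormal_frame_def)
  show "(T has_vector_derivative \<kappa> s *\<^sub>R N s - c *\<^sub>R \<alpha> s) (at s)"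
    using ambient_derivative_of_tangent_field[OF c I \<alpha>s tan(1) cov(1)] TT by simp
  show "(N has_vector_derivative - \<kappa> s *\<^sub>R T s + \<tau> s *\<^sub>R B s) (at s)"
    using ambient_derivative_of_tangent_field[OF c I \<alpha>s tan(2) cov(2)] NT by simp
  show "(B has_vector_derivative - \<tau> s *\<^sub>R N s) (at s)"
    using ambient_derivative_of_tangent_field[OF c I \<alpha>s tan(3) cov(3)] BT by simp
qed

section \<open>Uniform rotation and the curvature function\<close>

text \<open>Rotating the pair \<open>(x, y)\<close> back by the angle \<open>\<tau> s\<close> gives two functions with zero derivative;
  \<open>b\<close> is the polar angle of the resulting constant vector.\<close>

lemma uniform_rotation_solution:
  fixes x y :: "real \<Rightarrow> real"
  assumes I: "open I" "is_interval I" "I \<noteq> {}"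
    and dx: "\<And>s. s \<in> I \<Longrightarrow> (x has_real_derivative \<tau> * y s) (at s)"
    and dy: "\<And>s. s \<in> I \<Longrightarrow> (y has_real_derivative - \<tau> * x s) (at s)"
    and r: "r > 0" "\<And>s. s \<in> I \<Longrightarrow> (x s)\<^sup>2 + (y s)\<^sup>2 = r\<^sup>2"
  shows "\<exists>b. \<forall>s\<in>I. x s = r * sin (\<tau> * s + b)"
proof -
  define p where "p = (\<lambda>s. x s * cos (\<tau> * s) - y s * sin (\<tau> * s))"
  define q where "q = (\<lambda>s. x s * sin (\<tau> * s) + y s * cos (\<tau> * s))"
  have "(p has_real_derivative 0) (at s)" "(q has_real_derivative 0) (at s)" if "s \<in> I" for s
    unfolding p_def q_def
    by (rule derivative_eq_intros dx[OF that] dy[OF that] refl | simp add: algebra_simps)+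
  then obtain P Q where P: "\<And>s. s \<in> I \<Longrightarrow> p s = P" and Q: "\<And>s. s \<in> I \<Longrightarrow> q s = Q"
    using has_field_derivative_zero_constant[OF is_interval_convex[OF I(2)]]
      has_field_derivative_at_within by metis
  have x: "x s = P * cos (\<tau> * s) + Q * sin (\<tau> * s)" if "s \<in> I" for s
  proof -
    have "p s * cos (\<tau> * s) + q s * sin (\<tau> * s) = x s * ((cos (\<tau> * s))\<^sup>2 + (sin (\<tau> * s))\<^sup>2)"
      unfolding p_def q_def by algebra
    then show ?thesis using P Q that by simp
  qed
  obtain s0 where s0: "s0 \<in> I" using I(3) by blast
  have "(p s0)\<^sup>2 + (q s0)\<^sup>2 = ((x s0)\<^sup>2 + (y s0)\<^sup>2) * ((cos (\<tau> * s0))\<^sup>2 + (sin (\<tau> * s0))\<^sup>2)"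
    unfolding p_def q_def by algebra
  then have "P\<^sup>2 + Q\<^sup>2 = r\<^sup>2" using P Q s0 r(2) by simp
  then have "(Q / r)\<^sup>2 + (P / r)\<^sup>2 = 1"
    using r(1) by (simp add: power_divide add.commute flip: add_divide_distrib)
  then obtain b where "Q / r = cos b" "P / r = sin b" using sincos_total_2pi by metis
  then have "Q = r * cos b" "P = r * sin b" using r(1) by (auto simp: field_simps)
  then show ?thesis using x by (intro exI[of _ b]) (simp add: sin_add algebra_simps)
qed

theorem theorem3p1:
  fixes c \<omega> \<sigma> H \<tau> :: real
    and a :: "real^4"
    and I :: "real set"
    and \<alpha> T N B :: "real \<Rightarrow> real^4"
    and \<kappa> :: "real \<Rightarrow> real"
  assumes "c = -1 \<or> c = 1"
    and "\<omega> = -1 \<or> \<omega> = 1"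
    and "umbilical_surface c a \<sigma>"
    and "is_mean_curvature c a \<sigma> H"
    and "open I" "is_interval I" "I \<noteq> {}"
    and "Ck_curve 4 I \<alpha>"
    and "\<alpha> ` I \<subseteq> umb_set c a \<sigma>"
    and "frenet c \<omega> I \<alpha> T N B \<kappa> (\<lambda>_. \<tau>)"
    and "\<tau> \<noteq> 0"
    and "\<And>s. s \<in> I \<Longrightarrow> deriv \<kappa> s \<noteq> 0"
  shows "\<exists>b. \<forall>s\<in>I. \<kappa> s = \<bar>H\<bar> / sin (\<tau> * s + b)"
proof -
  note c = assms(1) and I = assms(5-7) and fr = assms(10)
  define r where "r = sqrt (mip c a a - c * \<sigma>\<^sup>2)"
  have r: "r > 0" "r\<^sup>2 = mip c a a - c * \<sigma>\<^sup>2"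
    using umbilical_surface_radius_pos[OF assms(3)] by (simp_all add: r_def)
  have on: "\<alpha> t \<in> space_form c" "mip c (\<alpha> t) a = \<sigma>" if "t \<in> I" for t
    using assms(9) that by (auto simp: umb_set_def)
  then have sf: "\<alpha> ` I \<subseteq> space_form c" by auto
  have F: "(\<alpha> has_vector_derivative T t) (at t)"
    "positive_orthonormal_frame c \<omega> (\<alpha> t) (T t) (N t) (B t)" "\<kappa> t > 0" if "t \<in> I" for t
    using fr that by (auto simp: frenet_def)
  define n where "n = (\<lambda>t. mip c (N t) a)"
  define m where "m = (\<lambda>t. mip c (B t) a)"
  have Ta: "mip c (T t) a = 0" if "t \<in> I" for t
    by (rule derivative_of_constant_on_open[OF I(1) that on(2)
          has_real_derivative_mip_const[OF F(1)[OF that]]])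
  have \<kappa>n: "\<kappa> t * n t = c * \<sigma>" if "t \<in> I" for t
    using derivative_of_constant_on_open[OF I(1) that Ta
        has_real_derivative_mip_const[OF frenet_ambient(1)[OF c I(1) that sf fr]]]
    by (simp add: mip_linear n_def on(2)[OF that])
  have dn: "(n has_real_derivative \<tau> * m t) (at t)" if "t \<in> I" for t
    using has_real_derivative_mip_const[OF frenet_ambient(2)[OF c I(1) that sf fr], of c a]
    by (simp add: mip_linear n_def m_def Ta[OF that])
  have dm: "(m has_real_derivative - \<tau> * n t) (at t)" if "t \<in> I" for t
    using has_real_derivative_mip_const[OF frenet_ambient(3)[OF c I(1) that sf fr], of c a]
    by (simp add: mip_linear n_def m_def)
  have nm: "(n t)\<^sup>2 + (m t)\<^sup>2 = r\<^sup>2" if "t \<in> I" for t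
  proof -
    have "mip c a a = mip c (mip c a (T t) *\<^sub>R T t + mip c a (N t) *\<^sub>R N t + mip c a (B t) *\<^sub>R B t
        + (c * mip c a (\<alpha> t)) *\<^sub>R \<alpha> t) a"
      using orthonormal_frame_expansion[OF c on(1)[OF that] F(2)[OF that], of a] by simp
    also have "\<dots> = (n t)\<^sup>2 + (m t)\<^sup>2 + c * \<sigma>\<^sup>2"
      using Ta[OF that] on(2)[OF that]
      by (simp add: mip_linear mip_commute[of c a] n_def m_def power2_eq_square)
    finally show ?thesis using r(2) by simp
  qed
  obtain s0 where s0: "s0 \<in> I" using I(3) by blast
  have "mip c (T s0) (T s0) = 1" using F(2)[OF s0] by (simp add: positive_orthonormal_frame_def)
  then have T0: "T s0 \<noteq> 0" by (auto simp: mip_def)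
  have H: "\<bar>H\<bar> = \<bar>\<sigma>\<bar> / r"
    by (rule abs_mean_curvature[OF c assms(4) r I(1) s0 assms(9) F(1)[OF s0] T0])
  \<comment> \<open>On a totally geodesic surface both normal components of \<open>a\<close> would vanish, since \<open>\<tau>\<close> does not.\<close>
  have \<sigma>0: "\<sigma> \<noteq> 0"
  proof
    assume "\<sigma> = 0"
    then have n0: "n t = 0" if "t \<in> I" for t using \<kappa>n[OF that] F(3)[OF that] by simp
    have "\<tau> * m s0 = 0" by (rule derivative_of_constant_on_open[OF I(1) s0 n0 dn[OF s0]])
    then show False using nm[OF s0] n0[OF s0] assms(11) r(1) by simp
  qed
  \<comment> \<open>The sign \<open>g\<close> turns \<open>\<kappa> n = c \<sigma>\<close> into \<open>\<kappa> (g n) = \<bar>\<sigma>\<bar>\<close>; if negative, it shifts the phase by \<open>\<pi>\<close>.\<close>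
  define g where "g = sgn (c * \<sigma>)"
  have g: "g * (c * \<sigma>) = \<bar>\<sigma>\<bar>" "g\<^sup>2 = 1"
    using c \<sigma>0 by (auto simp: g_def sgn_if)
  have "\<exists>b. \<forall>s\<in>I. g * n s = r * sin (\<tau> * s + b)"
  proof (rule uniform_rotation_solution[OF I _ _ r(1), where y = "\<lambda>s. g * m s"])
    fix s assume s: "s \<in> I"
    show "((\<lambda>s. g * n s) has_real_derivative \<tau> * (g * m s)) (at s)"
      using DERIV_cmult[OF dn[OF s], of g] by (simp add: algebra_simps)
    show "((\<lambda>s. g * m s) has_real_derivative - \<tau> * (g * n s)) (at s)"
      using DERIV_cmult[OF dm[OF s], of g] by (simp add: algebra_simps)
    show "(g * n s)\<^sup>2 + (g * m s)\<^sup>2 = r\<^sup>2" using nm[OF s] g(2) by (simp add: power_mult_distrib)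
  qed
  then obtain b where b: "\<And>s. s \<in> I \<Longrightarrow> g * n s = r * sin (\<tau> * s + b)" by blast
  have "\<kappa> s = \<bar>H\<bar> / sin (\<tau> * s + b)" if s: "s \<in> I" for s
  proof -
    have "\<kappa> s * (r * sin (\<tau> * s + b)) = g * (\<kappa> s * n s)"
      unfolding b[OF s, symmetric] by (simp add: algebra_simps)
    also have "\<dots> = \<bar>\<sigma>\<bar>" by (simp add: \<kappa>n[OF s] g(1))
    finally have *: "\<kappa> s * (r * sin (\<tau> * s + b)) = \<bar>\<sigma>\<bar>" .
    then have "sin (\<tau> * s + b) \<noteq> 0" using \<sigma>0 by auto
    then show ?thesis using * r(1) by (simp add: H field_simps)
  qed
  then show ?thesis by blast
qed

end
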